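(* Let $V$ be a countably infinite set and let $k:V\times V\to\mathbb{R}$ be strictly positive, with associated reproducing kernel Hilbert space $\mathscr{H}=\mathscr{H}(k)$. Let $x\in V$, and let $\mathscr{F}_x(V)$ be the collection of finite subsets $F\subset V$ with $x\in F$. For $F\in\mathscr{F}_x(V)$ put $D_F:=\det K_F$ and $D'_F:=\det K'_F$, where $K_F=(k(s,t))_{(s,t)\in F\times F}$ and $K'_F$ is the matrix obtained from $K_F$ by omitting row $x$ and column $x$. Then $$\delta_x\in\mathscr{H}\iff \sup_{F\in\mathscr{F}_x(V)}\frac{D'_F}{D_F}<\infty .$$
   Context: A function $k:V\times V\to\mathbb{R}$ is positive definite if $\sum_{(s,t)\in F\times F}k(s,t)\overline{c_s}c_t\ge 0$ for all finite $F\subset V$ and all coefficients $\{c_s\}_{s\in F}\subset\mathbb{C}$. A positive definite $k$ is strictly positive if $\det K_F>0$ for every finite $F\subset V$. Write $k_x:=k(\cdot,x)$. $\mathscr{H}(k)$ is the reproducing kernel Hilbert space of functions on $V$: the completion of $\mathrm{span}\{k_x: x\in V\}$ for the inner product determined by $\langle k_x,k_y\rangle_{\mathscr{H}}=k(x,y)$ (conjugate linear in the first variable), with $\langle k_x,f\rangle_{\mathscr{H}}=f(x)$ for all $f\in\mathscr{H}$, $x\in V$. $\delta_x$ is the function on $V$ equal to $1$ at $x$ and $0$ elsewhere. The determinant of the empty matrix is $1$. *)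

theory Defs
  imports "HOL-Analysis.Analysis" "HOL-Combinatorics.Permutations" "HOL-Library.Function_Algebras"
begin

text \<open>The underlying set \<open>V\<close> is the whole type \<open>'v\<close>; functions on \<open>V\<close> are functions \<open>'v \<Rightarrow> complex\<close>.\<close>

text \<open>Leibniz formula for a square matrix with rows and columns indexed by a finite set \<open>F\<close>; this is
  the formula defining \<^const>\<open>det\<close>, with \<open>F\<close> in place of a finite index type. Permuting rows and
  columns simultaneously does not change the determinant, so no enumeration of \<open>F\<close> is involved.\<close>

definition det_on :: "'v set \<Rightarrow> ('v \<Rightarrow> 'v \<Rightarrow> 'a::comm_ring_1) \<Rightarrow> 'a" where
  "det_on F A = (\<Sum>p\<in>{p. p permutes F}. of_int (sign p) * (\<Prod>s\<in>F. A s (p s)))"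

lemma det_on_UNIV: "det_on UNIV A = det (\<chi> i j. A i j)"
  by (simp add: det_on_def det_def)

lemma det_on_empty: "det_on {} A = 1"
  by (simp add: det_on_def)

definition positive_definite :: "('v \<Rightarrow> 'v \<Rightarrow> real) \<Rightarrow> bool" where
  "positive_definite k \<longleftrightarrow> (\<forall>F (c :: 'v \<Rightarrow> complex). finite F \<longrightarrow>
     (\<Sum>(s, t)\<in>F \<times> F. complex_of_real (k s t) * cnj (c s) * c t) \<in> \<real>\<^sub>\<ge>\<^sub>0)"

definition strictly_positive :: "('v \<Rightarrow> 'v \<Rightarrow> real) \<Rightarrow> bool" where
  "strictly_positive k \<longleftrightarrow> positive_definite k \<and> (\<forall>F. finite F \<longrightarrow> det_on F k > 0)"

definition kernel_section :: "('v \<Rightarrow> 'v \<Rightarrow> real) \<Rightarrow> 'v \<Rightarrow> 'v \<Rightarrow> complex" where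
  "kernel_section k x = (\<lambda>s. complex_of_real (k s x))"

definition fun_scale :: "complex \<Rightarrow> ('v \<Rightarrow> complex) \<Rightarrow> 'v \<Rightarrow> complex" where
  "fun_scale c f = (\<lambda>s. c * f s)"

global_interpretation fun_space: vector_space "fun_scale :: complex \<Rightarrow> ('v \<Rightarrow> complex) \<Rightarrow> _"
  by unfold_locales (auto simp: fun_scale_def algebra_simps fun_eq_iff)

text \<open>A complex Hilbert space whose vectors are functions on \<open>V\<close>, with pointwise operations. The
  inner product is only constrained on the carrier \<open>H\<close>. Conjugate linearity in the first variable
  follows from linearity in the second one and Hermitian symmetry.\<close>

locale function_hilbert_space =
  fixes H :: "('v \<Rightarrow> complex) set"
    and ip :: "('v \<Rightarrow> complex) \<Rightarrow> ('v \<Rightarrow> complex) \<Rightarrow> complex"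
  assumes subspace: "fun_space.subspace H"
    and ip_add_right: "\<lbrakk>f \<in> H; g \<in> H; h \<in> H\<rbrakk> \<Longrightarrow> ip f (g + h) = ip f g + ip f h"
    and ip_scale_right: "\<lbrakk>f \<in> H; g \<in> H\<rbrakk> \<Longrightarrow> ip f (fun_scale c g) = c * ip f g"
    and ip_commute: "\<lbrakk>f \<in> H; g \<in> H\<rbrakk> \<Longrightarrow> ip f g = cnj (ip g f)"
    and ip_nonneg: "f \<in> H \<Longrightarrow> ip f f \<in> \<real>\<^sub>\<ge>\<^sub>0"
    and ip_eq_zero: "\<lbrakk>f \<in> H; ip f f = 0\<rbrakk> \<Longrightarrow> f = 0"
    and complete:
      "\<lbrakk>\<And>n. X n \<in> H;
        \<forall>e>0. \<exists>N. \<forall>m\<ge>N. \<forall>n\<ge>N. sqrt (Re (ip (X m - X n) (X m - X n))) < e\<rbrakk>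
       \<Longrightarrow> \<exists>f\<in>H. (\<lambda>n. sqrt (Re (ip (X n - f) (X n - f)))) \<longlonglongrightarrow> 0"

text \<open>\<open>H\<close> with inner product \<open>ip\<close> is the reproducing kernel Hilbert space of \<open>k\<close>. By
  \<open>kernel_ip\<close>, \<open>dense\<close> and completeness it is a completion of the span of the functions
  \<open>k\<^sub>x\<close>; by \<open>reproducing\<close> the abstract completion is realised as a space of functions,
  which determines \<open>H\<close> and \<open>ip\<close> on \<open>H\<close> uniquely.\<close>

locale rkhs = function_hilbert_space H ip
  for k :: "'v \<Rightarrow> 'v \<Rightarrow> real"
    and H :: "('v \<Rightarrow> complex) set"
    and ip :: "('v \<Rightarrow> complex) \<Rightarrow> ('v \<Rightarrow> complex) \<Rightarrow> complex" +
  assumes kernel_mem: "kernel_section k x \<in> H"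
    and kernel_ip: "ip (kernel_section k x) (kernel_section k y) = complex_of_real (k x y)"
    and reproducing: "f \<in> H \<Longrightarrow> ip (kernel_section k x) f = f x"
    and dense: "\<lbrakk>f \<in> H; e > 0\<rbrakk> \<Longrightarrow>
      \<exists>g\<in>fun_space.span (range (kernel_section k)). sqrt (Re (ip (f - g) (f - g))) < e"

definition delta :: "'v \<Rightarrow> 'v \<Rightarrow> complex" where
  "delta x = (\<lambda>s. if s = x then 1 else 0)"

definition finite_sets_containing :: "'v \<Rightarrow> 'v set set" where
  "finite_sets_containing x = {F. finite F \<and> x \<in> F}"

definition D :: "('v \<Rightarrow> 'v \<Rightarrow> real) \<Rightarrow> 'v set \<Rightarrow> real" where
  "D k F = det_on F k"

text \<open>Omitting row and column \<open>x\<close> from \<open>K\<^sub>F\<close> leaves the matrix indexed by \<open>F - {x}\<close>.\<close>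

definition D' :: "('v \<Rightarrow> 'v \<Rightarrow> real) \<Rightarrow> 'v \<Rightarrow> 'v set \<Rightarrow> real" where
  "D' k x F = det_on (F - {x}) k"

end

theory Submission imports Defs begin

text \<open>For finite \<open>F\<close> containing \<open>x\<close>, let \<open>f\<^sub>F\<close> be the combination of the \<open>k\<^sub>t\<close> with \<open>t \<in> F\<close> that agrees
  with \<open>\<delta>\<^sub>x\<close> on \<open>F\<close>; Cramer's rule gives \<open>\<parallel>f\<^sub>F\<parallel>\<^sup>2 = D'\<^sub>F / D\<^sub>F\<close>. If \<open>\<delta>\<^sub>x \<in> H\<close>, then \<open>f\<^sub>F\<close> is its orthogonal
  projection onto the span of these \<open>k\<^sub>t\<close>, so the ratios are at most \<open>\<parallel>\<delta>\<^sub>x\<parallel>\<^sup>2\<close>. Conversely, for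
  \<open>F \<subseteq> G\<close> the same orthogonality gives \<open>\<parallel>f\<^sub>G - f\<^sub>F\<parallel>\<^sup>2 = D'\<^sub>G / D\<^sub>G - D'\<^sub>F / D\<^sub>F\<close>; hence, if the ratios
  are bounded, the \<open>f\<^sub>F\<close> along an exhaustion of \<open>V\<close> form a Cauchy sequence, whose limit is pointwise
  equal to \<open>\<delta>\<^sub>x\<close>.\<close>

section \<open>Determinants over a finite index set, up to Cramer's rule\<close>

lemma det_on_equal_rows:
  fixes A :: "'v \<Rightarrow> 'v \<Rightarrow> 'a::{idom,ring_char_0}"
  assumes F: "finite F" "x \<in> F" "y \<in> F" and "x \<noteq> y" and rows: "A x = A y"
  shows "det_on F A = 0"
proof -
  let ?t = "Transposition.transpose x y"
  let ?g = "\<lambda>p. of_int (sign p) * (\<Prod>s\<in>F. A s (p s)) :: 'a"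
  have t: "?t permutes F"
    using F by (simp add: permutes_swap_id)
  \<comment> \<open>Swapping \<open>x\<close> and \<open>y\<close> flips the sign, while the product
    is unchanged because the two rows agree. The determinant thus equals its own negative, and is
    zero in characteristic 0.\<close>
  have step: "?g (p \<circ> ?t) = - ?g p" if "p permutes F" for p
  proof -
    have "permutation p"
      using that F(1) permutation_permutes by blast
    then have "sign (p \<circ> ?t) = - sign p"
      using \<open>x \<noteq> y\<close> by (simp add: sign_compose permutation_swap_id sign_swap_id)
    moreover have "(\<Prod>s\<in>F. A s ((p \<circ> ?t) s)) = (\<Prod>s\<in>F. A (?t s) (p (?t s)))"
      using rows by (intro prod.cong) (auto simp: Transposition.transpose_def)
    moreover have "\<dots> = (\<Prod>s\<in>F. A s (p s))"
      using prod.permute[OF t, of "\<lambda>s. A s (p s)"] by (simp add: o_def)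
    ultimately show ?thesis by simp
  qed
  have "det_on F A = (\<Sum>p\<in>{p. p permutes F}. ?g (p \<circ> ?t))"
    unfolding det_on_def by (rule sum.reindex_bij_witness[of _ "\<lambda>p. p \<circ> ?t" "\<lambda>p. p \<circ> ?t"])
      (auto simp: o_assoc[symmetric] intro: permutes_compose t)
  also have "\<dots> = (\<Sum>p\<in>{p. p permutes F}. - ?g p)"
    by (intro sum.cong refl step) simp
  also have "\<dots> = - det_on F A"
    by (simp add: det_on_def sum_negf)
  finally show ?thesis
    by (simp add: eq_neg_iff_add_eq_0 flip: mult_2)
qed

lemma det_on_replace_row:
  assumes "finite F" "x \<in> F"
  shows "det_on F (A(x := v)) =
    (\<Sum>p\<in>{p. p permutes F}. of_int (sign p) * (\<Prod>s\<in>F-{x}. A s (p s)) * v (p x))"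
  unfolding det_on_def
proof (intro sum.cong refl)
  fix p
  have "(\<Prod>s\<in>F. (A(x := v)) s (p s)) = v (p x) * (\<Prod>s\<in>F-{x}. (A(x := v)) s (p s))"
    by (subst prod.remove[OF assms]) simp
  also have "(\<Prod>s\<in>F-{x}. (A(x := v)) s (p s)) = (\<Prod>s\<in>F-{x}. A s (p s))"
    by (intro prod.cong) auto
  finally show "of_int (sign p) * (\<Prod>s\<in>F. (A(x := v)) s (p s)) =
      of_int (sign p) * (\<Prod>s\<in>F-{x}. A s (p s)) * v (p x)"
    by (simp add: mult_ac)
qed

text \<open>Laplace expansion with each cofactor kept as a determinant over \<open>F\<close> having
  a unit vector in row \<open>x\<close>: a minor with different row and column index sets is not of
  the form \<open>det_on\<close>.\<close>

lemma det_on_expand_row: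
  assumes F: "finite F" "x \<in> F"
  shows "det_on F (A(x := v)) = (\<Sum>t\<in>F. v t * det_on F (A(x := (\<lambda>u. if u = t then 1 else 0))))"
proof -
  let ?a = "\<lambda>p. of_int (sign p) * (\<Prod>s\<in>F-{x}. A s (p s))"
  have "(\<Sum>t\<in>F. v t * det_on F (A(x := (\<lambda>u. if u = t then 1 else 0)))) =
      (\<Sum>p\<in>{p. p permutes F}. \<Sum>t\<in>F. v t * (?a p * (if p x = t then 1 else 0)))"
    unfolding det_on_replace_row[OF F] sum_distrib_left by (rule sum.swap)
  also have "\<dots> = (\<Sum>p\<in>{p. p permutes F}. ?a p * v (p x))"
  proof (rule sum.cong[OF refl])
    fix p assume "p \<in> {p. p permutes F}"
    then have px: "p x \<in> F"
      using F by (simp add: permutes_in_image)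
    have "(\<Sum>t\<in>F. v t * (?a p * (if p x = t then 1 else 0))) =
        (\<Sum>t\<in>F. if p x = t then ?a p * v t else 0)"
      by (intro sum.cong) (auto simp: mult_ac)
    then show "(\<Sum>t\<in>F. v t * (?a p * (if p x = t then 1 else 0))) = ?a p * v (p x)"
      using px F(1) by simp
  qed
  finally show ?thesis
    by (simp add: det_on_replace_row[OF F])
qed

text \<open>Only the permutations fixing \<open>x\<close> contribute, and these are the permutations
  of \<open>F - {x}\<close>, with the same signs.\<close>

lemma det_on_replace_row_unit:
  assumes F: "finite F" "x \<in> F"
  shows "det_on F (A(x := (\<lambda>u. if u = x then 1 else 0))) = det_on (F - {x}) A"
proof -
  let ?a = "\<lambda>p. of_int (sign p) * (\<Prod>s\<in>F-{x}. A s (p s))"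
  have "{p. p permutes F \<and> p x = x} = {p. p permutes F - {x}}"
  proof (intro Collect_cong iffI)
    fix p assume "p permutes F - {x}"
    then show "p permutes F \<and> p x = x"
      by (auto dest: permutes_not_in intro: permutes_subset)
  next
    fix p assume "p permutes F \<and> p x = x"
    then show "p permutes F - {x}"
      using permutes_superset[of p F "F - {x}"] by auto
  qed
  moreover have "(\<Sum>p\<in>{p. p permutes F}. ?a p * (if p x = x then 1 else 0)) =
      (\<Sum>p\<in>{p. p permutes F \<and> p x = x}. ?a p)"
    using finite_permutations[OF F(1)]
    by (intro sum.mono_neutral_cong_right) auto
  ultimately show ?thesis
    unfolding det_on_replace_row[OF F] by (simp add: det_on_def)
qed

lemma cramer_det_on:
  fixes A :: "'v \<Rightarrow> 'v \<Rightarrow> 'a::field_char_0"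
  assumes F: "finite F" "x \<in> F" and nz: "det_on F A \<noteq> 0"
  obtains c where "\<And>s. s \<in> F \<Longrightarrow> (\<Sum>t\<in>F. A s t * c t) = (if s = x then 1 else 0)"
    and "c x = det_on (F - {x}) A / det_on F A"
proof -
  let ?c = "\<lambda>t. det_on F (A(x := (\<lambda>u. if u = t then 1 else 0))) / det_on F A"
  have cx: "?c x = det_on (F - {x}) A / det_on F A"
    by (simp only: det_on_replace_row_unit[OF F])
  have "(\<Sum>t\<in>F. A s t * ?c t) = (if s = x then 1 else 0)" if s: "s \<in> F" for s
  proof -
    have "(\<Sum>t\<in>F. A s t * ?c t) = det_on F (A(x := A s)) / det_on F A"
      by (simp add: det_on_expand_row[OF F, of A "A s"] sum_divide_distrib)
    \<comment> \<open>For \<open>s = x\<close> the modified matrix is \<open>A\<close> itself;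
      otherwise its rows \<open>s\<close> and \<open>x\<close> coincide.\<close>
    also have "\<dots> = (if s = x then 1 else 0)"
      using nz det_on_equal_rows[OF F(1) F(2) s, of "A(x := A s)"] by auto
    finally show ?thesis .
  qed
  from that[of ?c, OF this cx] show thesis .
qed

section \<open>Inner product calculus on the carrier\<close>

context function_hilbert_space
begin

lemma zero_mem: "0 \<in> H"
  by (rule fun_space.subspace_0[OF subspace])

lemma add_mem: "f \<in> H \<Longrightarrow> g \<in> H \<Longrightarrow> f + g \<in> H"
  by (rule fun_space.subspace_add[OF subspace])

lemma scale_mem: "f \<in> H \<Longrightarrow> fun_scale c f \<in> H"
  by (rule fun_space.subspace_scale[OF subspace])

lemma diff_mem: "f \<in> H \<Longrightarrow> g \<in> H \<Longrightarrow> f - g \<in> H"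
  by (rule fun_space.subspace_diff[OF subspace])

lemma sum_mem: "(\<And>t. t \<in> F \<Longrightarrow> f t \<in> H) \<Longrightarrow> (\<Sum>t\<in>F. f t) \<in> H"
  by (rule fun_space.subspace_sum[OF subspace])

lemma ip_add_left: "\<lbrakk>f \<in> H; g \<in> H; h \<in> H\<rbrakk> \<Longrightarrow> ip (f + g) h = ip f h + ip g h"
  by (metis add_mem complex_cnj_add ip_add_right ip_commute)

lemma ip_scale_left: "\<lbrakk>f \<in> H; g \<in> H\<rbrakk> \<Longrightarrow> ip (fun_scale c f) g = cnj c * ip f g"
  by (metis scale_mem complex_cnj_mult ip_scale_right ip_commute)

lemma ip_zero_left: "g \<in> H \<Longrightarrow> ip 0 g = 0"
  using ip_scale_left[of 0 g 0] zero_mem by (simp add: fun_scale_def zero_fun_def)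

lemma ip_diff_right: "\<lbrakk>f \<in> H; g \<in> H; h \<in> H\<rbrakk> \<Longrightarrow> ip f (g - h) = ip f g - ip f h"
  using ip_add_right[of f "g - h" h] by (simp add: diff_mem)

lemma ip_diff_left: "\<lbrakk>f \<in> H; g \<in> H; h \<in> H\<rbrakk> \<Longrightarrow> ip (f - g) h = ip f h - ip g h"
  using ip_add_left[of "f - g" g h] by (simp add: diff_mem)

lemma ip_sum_left:
  assumes "finite F" "\<And>t. t \<in> F \<Longrightarrow> f t \<in> H" "g \<in> H"
  shows "ip (\<Sum>t\<in>F. f t) g = (\<Sum>t\<in>F. ip (f t) g)"
  using assms by (induction F) (simp_all add: ip_zero_left ip_add_left sum_mem)

lemma Re_ip_nonneg: "f \<in> H \<Longrightarrow> 0 \<le> Re (ip f f)"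
  using ip_nonneg[of f] by (auto simp: complex_nonneg_Reals_iff)

text \<open>Pythagoras: the last hypothesis says that \<open>g - f\<close> is orthogonal to
  \<open>f\<close>.\<close>

lemma ip_diff_self:
  assumes "f \<in> H" "g \<in> H" "ip f g = ip f f"
  shows "ip (g - f) (g - f) = ip g g - ip f f"
proof -
  have "ip g f = ip f f"
    using assms by (metis ip_commute)
  then show ?thesis
    using assms by (simp add: ip_diff_left ip_diff_right diff_mem)
qed

end

section \<open>Point evaluations and interpolants of the delta function\<close>

context rkhs
begin

lemma kernel_commute: "k s t = k t s"
  using ip_commute[OF kernel_mem kernel_mem, of s t] by (simp add: kernel_ip)

text \<open>Cauchy-Schwarz for the pairing with \<open>kernel_section k s\<close>. It makes point
  evaluations continuous, so that norm limits are pointwise limits.\<close>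

lemma norm_eval_le:
  assumes f: "f \<in> H" and pos: "k s s > 0"
  shows "norm (f s) \<le> sqrt (k s s) * sqrt (Re (ip f f))"
proof -
  \<comment> \<open>The orthogonal projection of \<open>f\<close> onto the line spanned by
    \<open>kernel_section k s\<close>.\<close>
  let ?g = "fun_scale (f s / k s s) (kernel_section k s)"
  have g: "?g \<in> H"
    by (simp add: kernel_mem scale_mem)
  have ff: "ip ?g f = cnj (f s) * f s / k s s"
    using f by (simp add: ip_scale_left kernel_mem reproducing)
  also have "\<dots> = ip ?g ?g"
    using pos by (simp add: ip_scale_left ip_scale_right kernel_mem scale_mem kernel_ip)
  finally have "ip (f - ?g) (f - ?g) = ip f f - cnj (f s) * f s / k s s"
    using ip_diff_self[OF g f] ff by simp
  moreover have "cnj (f s) * f s / k s s = complex_of_real ((norm (f s))\<^sup>2 / k s s)"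
    by (simp add: complex_norm_square mult.commute del: of_real_power)
  ultimately have "(norm (f s))\<^sup>2 / k s s \<le> Re (ip f f)"
    using Re_ip_nonneg[OF diff_mem[OF f g]] by (simp del: of_real_divide of_real_power)
  then have "(norm (f s))\<^sup>2 \<le> k s s * Re (ip f f)"
    using pos by (simp add: field_simps)
  then show ?thesis
    by (metis real_le_rsqrt real_sqrt_mult)
qed

text \<open>By the reproducing property \<open>ip f g\<close> depends only on \<open>g\<close>
  restricted to \<open>F\<close>, and only the coefficient at \<open>x\<close>, given by Cramer's
  rule, survives. Admissible \<open>g\<close> include \<open>f\<close> itself, interpolants on
  larger sets and, if it lies in \<open>H\<close>, \<open>delta x\<close>.\<close>

lemma interpolant:
  assumes F: "finite F" "x \<in> F" and nz: "D k F \<noteq> 0"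
  obtains f where "f \<in> H" "\<And>s. s \<in> F \<Longrightarrow> f s = delta x s"
    "\<And>g. \<lbrakk>g \<in> H; \<And>s. s \<in> F \<Longrightarrow> g s = delta x s\<rbrakk> \<Longrightarrow> ip f g = complex_of_real (D' k x F / D k F)"
proof -
  obtain c where c: "\<And>s. s \<in> F \<Longrightarrow> (\<Sum>t\<in>F. k s t * c t) = (if s = x then 1 else 0)"
    and cx: "c x = D' k x F / D k F"
    using cramer_det_on[OF F, of k] nz unfolding D_def D'_def by metis
  define f where "f = (\<Sum>t\<in>F. fun_scale (complex_of_real (c t)) (kernel_section k t))"
  have f: "f \<in> H"
    unfolding f_def by (intro sum_mem scale_mem kernel_mem)
  have ip_f: "ip f g = (\<Sum>t\<in>F. complex_of_real (c t) * g t)" if "g \<in> H" for g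
    unfolding f_def using that F(1)
    by (simp add: ip_sum_left ip_scale_left scale_mem kernel_mem reproducing)
  show thesis
  proof (rule that[OF f])
    fix s assume s: "s \<in> F"
    have "f s = cnj (ip f (kernel_section k s))"
      using f by (metis ip_commute kernel_mem reproducing)
    also have "\<dots> = complex_of_real (\<Sum>t\<in>F. k s t * c t)"
      unfolding ip_f[OF kernel_mem]
      by (simp add: kernel_section_def kernel_commute[of s] mult.commute)
    finally show "f s = delta x s"
      using c[OF s] by (simp add: delta_def)
  next
    fix g assume g: "g \<in> H" "\<And>s. s \<in> F \<Longrightarrow> g s = delta x s"
    have "ip f g = (\<Sum>t\<in>F. if t = x then complex_of_real (c t) else 0)"
      unfolding ip_f[OF g(1)] by (intro sum.cong) (auto simp: g(2) delta_def)
    then show "ip f g = complex_of_real (D' k x F / D k F)"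
      using F cx by simp
  qed
qed

lemma delta_mem_if_bounded:
  assumes cnt: "countable (UNIV :: 'v set)"
    and pos: "\<And>F. finite F \<Longrightarrow> D k F > 0"
    and bound: "\<And>F. \<lbrakk>finite F; x \<in> F\<rbrakk> \<Longrightarrow> D' k x F / D k F \<le> M"
  shows "delta x \<in> H"
proof -
  \<comment> \<open>An increasing exhaustion of the countable set; inserting \<open>x\<close> makes
    every member admissible, even \<open>F 0\<close>.\<close>
  define F where "F n = insert x (from_nat_into UNIV ` {..<n})" for n :: nat
  define r where "r n = D' k x (F n) / D k (F n)" for n
  have fin: "finite (F n)" and xF: "x \<in> F n" for n
    by (auto simp: F_def)
  have mono: "F m \<subseteq> F n" if "m \<le> n" for m n
    using that by (auto simp: F_def)
  have "\<exists>f. f \<in> H \<and> (\<forall>s\<in>F n. f s = delta x s) \<and>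
      (\<forall>g\<in>H. (\<forall>s\<in>F n. g s = delta x s) \<longrightarrow> ip f g = complex_of_real (r n))" for n
  proof -
    have "D k (F n) \<noteq> 0"
      using pos[OF fin, of n] by simp
    from interpolant[OF fin xF this] show ?thesis
      unfolding r_def by metis
  qed
  then obtain X where X: "\<And>n. X n \<in> H" and eval: "\<And>n s. s \<in> F n \<Longrightarrow> X n s = delta x s"
    and ipX: "\<And>n g. \<lbrakk>g \<in> H; \<And>s. s \<in> F n \<Longrightarrow> g s = delta x s\<rbrakk> \<Longrightarrow> ip (X n) g = complex_of_real (r n)"
    by metis
  have dist: "Re (ip (X n - X m) (X n - X m)) = r n - r m" if "m \<le> n" for m n
  proof -
    \<comment> \<open>\<open>X n\<close> agrees with \<open>delta x\<close> on \<open>F n\<close>,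
      hence on the smaller set \<open>F m\<close>, so it may be paired with
      \<open>X m\<close>.\<close>
    have "ip (X m) (X n) = r m" "ip (X m) (X m) = r m" "ip (X n) (X n) = r n"
      using mono[OF that] by (auto intro!: ipX X eval)
    then show ?thesis
      using ip_diff_self[OF X X, of m n] by simp
  qed
  have "incseq r"
    unfolding incseq_def using dist Re_ip_nonneg[OF diff_mem[OF X X]]
    by (metis diff_ge_0_iff_ge)
  moreover have "r n \<le> M" for n
    unfolding r_def by (rule bound[OF fin xF])
  ultimately have "convergent r"
    by (meson convergentI incseq_convergent)
  then have cau: "Cauchy r"
    by (simp add: Cauchy_convergent_iff)
  have "\<forall>e>0. \<exists>N. \<forall>m\<ge>N. \<forall>n\<ge>N. sqrt (Re (ip (X m - X n) (X m - X n))) < e"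
  proof (intro allI impI)
    fix e :: real assume "e > 0"
    \<comment> \<open>The differences of \<open>r\<close> are squared distances, hence the square of
      \<open>e\<close>.\<close>
    obtain N where N: "\<And>m n. \<lbrakk>m \<ge> N; n \<ge> N\<rbrakk> \<Longrightarrow> \<bar>r m - r n\<bar> < e\<^sup>2"
      using CauchyD[OF cau, of "e\<^sup>2"] \<open>e > 0\<close> by auto
    have swap: "ip (X m - X n) (X m - X n) = ip (X n - X m) (X n - X m)" for m n
      by (simp add: ip_diff_left ip_diff_right diff_mem X)
    have "Re (ip (X m - X n) (X m - X n)) = \<bar>r m - r n\<bar>" for m n
      using dist[of m n] dist[of n m] Re_ip_nonneg[OF diff_mem[OF X[of m] X[of n]]] swap[of m n]
      by (cases "m \<le> n") auto
    moreover have "sqrt \<bar>r m - r n\<bar> < e" if "m \<ge> N" "n \<ge> N" for m n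
      using N[OF that] \<open>e > 0\<close> by (simp add: real_less_lsqrt)
    ultimately show "\<exists>N. \<forall>m\<ge>N. \<forall>n\<ge>N. sqrt (Re (ip (X m - X n) (X m - X n))) < e"
      by (intro exI[of _ N]) simp
  qed
  from complete[of X, OF X this] obtain f
    where f: "f \<in> H" and lim: "(\<lambda>n. sqrt (Re (ip (X n - f) (X n - f)))) \<longlonglongrightarrow> 0"
    by (elim bexE)
  have "f s = delta x s" for s
  proof -
    \<comment> \<open>The diagonal entry is the determinant for the singleton
      \<open>{s}\<close>.\<close>
    have "k s s > 0"
      using pos[of "{s}"] by (simp add: D_def det_on_def)
    then have "norm (X n s - f s) \<le> sqrt (k s s) * sqrt (Re (ip (X n - f) (X n - f)))" for n
      using norm_eval_le[OF diff_mem[OF X f], of s n] by simp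
    then have "(\<lambda>n. X n s - f s) \<longlonglongrightarrow> 0"
      by (rule Lim_null_comparison[OF always_eventually[OF allI] tendsto_mult_right_zero[OF lim]])
    then have to_f: "(\<lambda>n. X n s) \<longlonglongrightarrow> f s"
      by (rule LIM_zero_cancel)
    have "s \<in> F n" if "n > to_nat_on UNIV s" for n
    proof -
      have "from_nat_into UNIV (to_nat_on UNIV s) = s"
        using cnt by simp
      then have "s \<in> from_nat_into UNIV ` {..<n}"
        using that by (metis imageI lessThan_iff)
      then show ?thesis
        by (simp add: F_def)
    qed
    then have "eventually (\<lambda>n. X n s = delta x s) sequentially"
      by (intro eventually_mono[OF eventually_gt_at_top[of "to_nat_on UNIV s"]] eval)
    then have "(\<lambda>n. X n s) \<longlonglongrightarrow> delta x s"
      by (rule tendsto_eventually)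
    with to_f show ?thesis
      by (rule LIMSEQ_unique)
  qed
  then have "f = delta x"
    by (rule ext)
  with f show ?thesis
    by simp
qed

end

text \<open>The supremum lives in \<open>ereal\<close>, where unbounded ratios give infinity; in
  \<open>real\<close> it would have no meaningful value for them.\<close>

theorem corollary2p11:
  fixes k :: "'v \<Rightarrow> 'v \<Rightarrow> real"
    and H :: "('v \<Rightarrow> complex) set"
    and ip :: "('v \<Rightarrow> complex) \<Rightarrow> ('v \<Rightarrow> complex) \<Rightarrow> complex"
    and x :: 'v
  assumes "countable (UNIV :: 'v set)" and "infinite (UNIV :: 'v set)"
    and "strictly_positive k"
    and "rkhs k H ip"
  shows "delta x \<in> H \<longleftrightarrow>
    (SUP F\<in>finite_sets_containing x. ereal (D' k x F / D k F)) < \<infinity>"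
    (is "_ \<longleftrightarrow> ?S < \<infinity>")
proof
  interpret rkhs k H ip by fact
  have pos: "D k F > 0" if "finite F" for F
    using assms(3) that by (simp add: strictly_positive_def D_def)
  {
    assume d: "delta x \<in> H"
    have "D' k x F / D k F \<le> Re (ip (delta x) (delta x))" if F: "finite F" "x \<in> F" for F
    proof -
      obtain f where f: "f \<in> H" "\<And>s. s \<in> F \<Longrightarrow> f s = delta x s"
        and ipf: "\<And>g. \<lbrakk>g \<in> H; \<And>s. s \<in> F \<Longrightarrow> g s = delta x s\<rbrakk> \<Longrightarrow>
          ip f g = complex_of_real (D' k x F / D k F)"
        using interpolant[OF F] pos[OF F(1)] by (metis less_irrefl)
      \<comment> \<open>Both \<open>f\<close> and \<open>delta x\<close> are admissible in
        \<open>ipf\<close>, so \<open>f\<close> has the same inner product with each.\<close>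
      have "ip (delta x - f) (delta x - f) = ip (delta x) (delta x) - ip f f"
        using ip_diff_self[OF f(1) d] ipf f d by simp
      then show ?thesis
        using Re_ip_nonneg[OF diff_mem[OF d f(1)]] ipf[OF f] by simp
    qed
    then have "?S \<le> ereal (Re (ip (delta x) (delta x)))"
      by (auto intro!: SUP_least simp: finite_sets_containing_def)
    then show "?S < \<infinity>"
      using ereal_infty_less(1) le_less_trans less_ereal.simps(4) by blast
  next
    assume "?S < \<infinity>"
    then obtain M where M: "?S < ereal M"
      using less_PInf_Ex_of_nat by auto
    have "D' k x F / D k F \<le> M" if "finite F" "x \<in> F" for F
    proof -
      have "ereal (D' k x F / D k F) \<le> ?S"
        using that by (intro SUP_upper) (simp add: finite_sets_containing_def)
      then show ?thesis
        using M by (metis ereal_less_eq(3) le_less_trans less_imp_le)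
    qed
    then show "delta x \<in> H"
      using delta_mem_if_bounded[OF assms(1) pos] by blast
  }
qed

end
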